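(* Let $q>9$ be an odd prime power and let $U$ be an intersecting family of $q^2-\varepsilon$ polynomials over $\mathbb{F}_q$ of degree at most $2$, where $\varepsilon<\frac{q\sqrt{q}}{4}-\frac{3q}{8}-\frac{\sqrt{q}}{8}$. Then the graphs of the polynomials in $U$ share a common point.
   Context: The graph of $f\colon\mathbb{F}_q\to\mathbb{F}_q$ is $\{(x,f(x)):x\in\mathbb{F}_q\}$. A set of polynomials over $\mathbb{F}_q$ is intersecting if the graphs of any two of its members share at least one point. *)

theory Defs
  imports "HOL-Computational_Algebra.Polynomial" "HOL-Library.Cardinality" Complex_Main
begin

definition intersecting_family :: "'a::comm_ring_1 poly set \<Rightarrow> bool" where
  "intersecting_family U \<longleftrightarrow> (\<forall>f\<in>U. \<forall>g\<in>U. \<exists>x. poly f x = poly g x)"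

end

theory Submission
  imports Defs "HOL-Analysis.Convex"
begin

text \<open>
  Let \<open>q\<close> be the order of the field, \<open>N\<close> the size of \<open>U\<close>, and \<open>u x y\<close> the number of members of
  \<open>U\<close> through the point \<open>(x, y)\<close>.  If some member of \<open>U\<close> misses \<open>(x, y)\<close>, a discriminant count
  gives \<open>u x y \<le> q(q+1)/2\<close>, so it suffices to find a more popular point.

  For every nonsquare \<open>n\<close> and every \<open>x\<close>, the Cauchy-Schwarz inequality for the fibres of
  \<open>f \<mapsto> f(x) - n \<sqdot> (leading coefficient of f)\<close> bounds a number of pairs in \<open>U\<close> from below.  Summed over
  \<open>x\<close> and \<open>n\<close>, it says that most pairs meet twice: the sum of the \<open>u x y\<^sup>2\<close> is at least \<open>2N\<^sup>2 - qN\<close>.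
  Hence \<open>G(g) = (\<Sum>x. u x (g x) - N/q)\<close>, as a function on all quadratic polynomials \<open>g\<close>, is close to
  \<open>q\<^sup>2\<close> times the indicator of \<open>U\<close>.  The values of a random \<open>g\<close> at three points are independent, so
  the third moment of \<open>G\<close> is \<open>q\<^sup>2\<close> times the sum of the \<open>(u x y - N/q)\<^sup>3\<close>; comparing it with the second
  moment forces some \<open>u x y\<close> to be larger than \<open>q(q+1)/2\<close>.
\<close>

section \<open>Squares in finite fields of odd order\<close>

definition nonsquares :: "'a::field set" where
  "nonsquares = - range (\<lambda>y. y ^ 2)"

text \<open>Translation by 1 permutes the field, so comparing the sums of x + 1 and of x gives q = 0
  in the field. If 2 = 0 as well, an odd q would force 1 = 0.\<close>

lemma two_neq_zero_if_odd_CARD: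
  assumes "odd CARD('a::{field,finite})"
  shows "(2::'a) \<noteq> 0"
proof
  assume two: "(2::'a) = 0"
  have "(\<Sum>x\<in>UNIV. x + 1) = (\<Sum>x\<in>(UNIV::'a set). x)"
    by (rule sum.reindex_bij_witness[of _ "\<lambda>x. x - 1" "\<lambda>x. x + 1"]) auto
  then have "of_nat CARD('a) = (0::'a)"
    by (simp add: sum.distrib)
  moreover obtain m where "CARD('a) = 2 * m + 1"
    using assms by (auto elim: oddE)
  ultimately show False
    using two by simp
qed

text \<open>Each nonzero square has two distinct roots y and -y, so there are at most (q-1)/2 of
  them; the square 0 adds one more.\<close>

lemma card_range_square_le:
  assumes "odd CARD('a::{field,finite})"
  shows "2 * card (range (\<lambda>y::'a. y ^ 2)) \<le> CARD('a) + 1"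
proof -
  let ?S = "range (\<lambda>y::'a. y ^ 2)"
  have fibre: "2 \<le> card {y::'a. y ^ 2 = s}" if s: "s \<in> ?S - {0}" for s
  proof -
    obtain y where y: "s = y ^ 2" "y \<noteq> 0"
      using s by auto
    have "y \<noteq> - y"
      using y(2) two_neq_zero_if_odd_CARD[OF assms]
      by (metis add.right_inverse mult_2 mult_eq_0_iff)
    then have "card {y, - y} = 2"
      by simp
    moreover have "{y, - y} \<subseteq> {y. y ^ 2 = s}"
      using y by auto
    ultimately show ?thesis
      by (metis card_mono finite)
  qed
  have "2 * card (?S - {0}) \<le> (\<Sum>s\<in>?S - {0}. card {y::'a. y ^ 2 = s})"
    using sum_mono[OF fibre, of "?S - {0}" "\<lambda>s. s"] by simp
  also have "\<dots> = card (\<Union>s\<in>?S - {0}. {y::'a. y ^ 2 = s})"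
    by (subst card_UN_disjoint) auto
  also have "\<dots> \<le> card (UNIV - {0::'a})"
    by (rule card_mono) auto
  also have "\<dots> = CARD('a) - 1"
    by simp
  finally have "2 * card (?S - {0}) \<le> CARD('a) - 1" .
  moreover have "card (?S - {0}) = card ?S - 1"
    by (rule card_Diff_singleton) (auto intro: range_eqI[of _ _ 0])
  ultimately show ?thesis
    using zero_less_card_finite[where 'a = 'a] by linarith
qed

lemma card_nonsquares_pos:
  assumes "odd CARD('a::{field,finite})" "CARD('a) > 1"
  shows "card (nonsquares :: 'a set) > 0"
proof -
  have "range (\<lambda>y::'a. y ^ 2) \<noteq> UNIV"
    using card_range_square_le[OF assms(1)] assms(2) by auto
  then show ?thesis
    by (auto simp: nonsquares_def card_gt_0_iff)
qed

text \<open>Up to the square \<open>(x - s)\<^sup>2\<close>, the product is \<open>(x - r) / (x - s)\<close>, which is injective in \<open>x\<close> and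
  misses only the square \<open>1\<close>.\<close>

lemma card_product_in_nonsquares:
  assumes "(r::'a::{field,finite}) \<noteq> s"
  shows "card {x. (x - r) * (x - s) \<in> nonsquares} = card (nonsquares :: 'a set)"
proof (rule bij_betw_same_card)
  have mult: "a * b ^ 2 \<in> nonsquares \<longleftrightarrow> a \<in> nonsquares" if "b \<noteq> 0" for a b :: 'a
  proof -
    have "a * b ^ 2 = y ^ 2 \<longleftrightarrow> a = (y / b) ^ 2" for y
      using that by (simp add: power_divide eq_divide_eq)
    moreover have "a = y ^ 2 \<longleftrightarrow> a * b ^ 2 = (y * b) ^ 2" for y
      using that by (simp add: power_mult_distrib)
    ultimately have "(\<exists>y. a * b ^ 2 = y ^ 2) \<longleftrightarrow> (\<exists>y. a = y ^ 2)"
      by blast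
    then show ?thesis
      by (simp add: nonsquares_def image_iff)
  qed
  have zero: "(0::'a) \<notin> nonsquares" and one: "(1::'a) \<notin> nonsquares"
    unfolding nonsquares_def by (auto intro: range_eqI[of _ _ 0] range_eqI[of _ _ 1])
  have iff: "(x - r) * (x - s) \<in> nonsquares \<longleftrightarrow> x \<noteq> s \<and> (x - r) / (x - s) \<in> nonsquares" for x
  proof (cases "x = s")
    case False
    then have "(x - r) * (x - s) = (x - r) / (x - s) * (x - s) ^ 2"
      by (simp add: power2_eq_square)
    then show ?thesis
      using mult[of "x - s" "(x - r) / (x - s)"] False by simp
  qed (simp add: zero)
  \<comment> \<open>The inverse map comes from solving (x - r)/(x - s) = t for x. These two
    identities show that the product (x - r)(x - s) is then t times a nonzero square.\<close>
  have *: "(r - t * s) / (1 - t) - r = t * ((r - s) / (1 - t))"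
    "(r - t * s) / (1 - t) - s = (r - s) / (1 - t)" if "t \<noteq> 1" for t
    using that by (simp_all add: field_simps)
  show "bij_betw (\<lambda>x. (x - r) / (x - s)) {x. (x - r) * (x - s) \<in> nonsquares} (nonsquares :: 'a set)"
  proof (rule bij_betw_byWitness[where f' = "\<lambda>t. (r - t * s) / (1 - t)"], goal_cases)
    case 1
    show ?case
    proof
      fix x assume "x \<in> {x. (x - r) * (x - s) \<in> nonsquares}"
      then have "x - s \<noteq> 0"
        using iff by auto
      then have "r - (x - r) / (x - s) * s = x * ((r - s) / (x - s))"
        "1 - (x - r) / (x - s) = (r - s) / (x - s)"
        by (simp_all add: field_simps)
      then show "(r - (x - r) / (x - s) * s) / (1 - (x - r) / (x - s)) = x"
        using assms \<open>x - s \<noteq> 0\<close> by simp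
    qed
  next
    case 2
    show ?case
    proof
      fix t :: 'a assume "t \<in> nonsquares"
      then have "t \<noteq> 1"
        using one by auto
      then show "((r - t * s) / (1 - t) - r) / ((r - t * s) / (1 - t) - s) = t"
        using assms by (simp add: *)
    qed
  next
    case 3
    then show ?case
      using iff by auto
  next
    case 4
    show ?case
    proof clarify
      fix t :: 'a assume t: "t \<in> nonsquares"
      then have "t \<noteq> 1"
        using one by auto
      then show "((r - t * s) / (1 - t) - r) * ((r - t * s) / (1 - t) - s) \<in> nonsquares"
        using t mult[of "(r - s) / (1 - t)" t] assms
        by (simp add: * power2_eq_square mult.assoc)
    qed
  qed
qed

section \<open>Quadratic polynomials\<close>

lemma degree_le_2_eq:
  assumes "degree f \<le> 2"
  shows "f = [:coeff f 0, coeff f 1, coeff f 2:]"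
proof (rule poly_eqI)
  fix n :: nat
  consider "n = 0" | "n = 1" | "n = 2" | "n > 2"
    by linarith
  then show "coeff f n = coeff [:coeff f 0, coeff f 1, coeff f 2:] n"
    using assms by cases (auto simp: coeff_pCons numeral_2_eq_2 coeff_eq_0 split: nat.split)
qed

lemma card_degree_le_2:
  "finite {f::'a::{field,finite} poly. degree f \<le> 2}"
  "card {f::'a::{field,finite} poly. degree f \<le> 2} = CARD('a) ^ 3"
proof -
  have bij: "bij_betw (\<lambda>(a, b, c). [:a, b, c:]) UNIV {f::'a poly. degree f \<le> 2}"
  proof (rule bij_betw_byWitness[where f' = "\<lambda>f. (coeff f 0, coeff f 1, coeff f 2)"], goal_cases)
    case 2
    show ?case
      by (auto simp del: One_nat_def simp flip: degree_le_2_eq)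
  qed (auto simp: numeral_2_eq_2)
  show "finite {f::'a poly. degree f \<le> 2}"
    using bij_betw_finite[OF bij] by simp
  show "card {f::'a poly. degree f \<le> 2} = CARD('a) ^ 3"
    using bij_betw_same_card[OF bij] by (simp add: power3_eq_cube)
qed

lemma poly_degree_le_2:
  fixes f :: "'a::comm_ring_1 poly"
  assumes "degree f \<le> 2"
  shows "poly f x = coeff f 0 + coeff f 1 * x + coeff f 2 * x ^ 2"
proof -
  have "poly f x = poly [:coeff f 0, coeff f 1, coeff f 2:] x"
    by (rule arg_cong[OF degree_le_2_eq[OF assms]])
  also have "\<dots> = coeff f 0 + coeff f 1 * x + coeff f 2 * x ^ 2"
    by (simp add: algebra_simps power2_eq_square)
  finally show ?thesis .
qed

text \<open>Agreement at three points would give a nonzero difference of degree at most 2 three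
  roots; both sides have q^3 elements, so injectivity suffices. This is the independence of values
  at three points.\<close>

lemma bij_betw_evaluate:
  fixes x y z :: "'a::{field,finite}"
  assumes "x \<noteq> y" "x \<noteq> z" "y \<noteq> z"
  shows "bij_betw (\<lambda>f. (poly f x, poly f y, poly f z)) {f. degree f \<le> 2} UNIV"
proof -
  let ?ev = "\<lambda>f. (poly f x, poly f y, poly f z)"
  have inj: "inj_on ?ev {f. degree f \<le> 2}"
  proof (rule inj_onI)
    fix f g assume f: "f \<in> {f. degree f \<le> 2}" and g: "g \<in> {f. degree f \<le> 2}" and eq: "?ev f = ?ev g"
    show "f = g"
    proof (rule ccontr)
      assume "f \<noteq> g"
      then have "card {t. poly (f - g) t = 0} \<le> degree (f - g)"
        by (intro card_poly_roots_bound) auto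
      also have "\<dots> \<le> 2"
        using f g by (intro degree_diff_le) auto
      finally have "card {t. poly (f - g) t = 0} \<le> 2" .
      moreover have "card {x, y, z} \<le> card {t. poly (f - g) t = 0}"
        using eq by (intro card_mono) auto
      ultimately show False
        using assms by simp
    qed
  qed
  moreover have "?ev ` {f. degree f \<le> 2} = UNIV"
  proof (rule card_subset_eq)
    show "card (?ev ` {f. degree f \<le> 2}) = card (UNIV :: ('a \<times> 'a \<times> 'a) set)"
      using card_image[OF inj] by (simp add: card_degree_le_2 power3_eq_cube)
  qed auto
  ultimately show ?thesis
    by (simp add: bij_betw_def)
qed

lemma sum_evaluate:
  fixes x y z :: "'a::{field,finite}" and H :: "'a \<Rightarrow> 'a \<Rightarrow> 'a \<Rightarrow> real"
  assumes "x \<noteq> y" "x \<noteq> z" "y \<noteq> z"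
  shows "(\<Sum>f | degree f \<le> 2. H (poly f x) (poly f y) (poly f z)) = (\<Sum>a\<in>UNIV. \<Sum>b\<in>UNIV. \<Sum>c\<in>UNIV. H a b c)"
  using sum.reindex_bij_betw[OF bij_betw_evaluate[OF assms], of "\<lambda>(a, b, c). H a b c"]
  by (simp add: sum.cartesian_product flip: UNIV_Times_UNIV)

text \<open>Write a for the coefficient of x^2 and p for the number of nonsquares. If a = 0, every n
  gives back the root equation, and both sides are p plus p times the number of roots. Otherwise h =
  a(x - r)(x - s), and the sum counts the x with (x - r)(x - s) a nonsquare: p if r and s differ,
  none if r = s. Applied to h = f - g, this trades common points for coincidences of f(x) - n
  lead(f).\<close>

lemma poly_with_root_count:
  fixes h :: "'a::{field,finite} poly"
  assumes deg: "degree h \<le> 2" and root: "poly h r = 0"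
  shows "card (nonsquares :: 'a set) * card {x. poly h x = 0}
      + card (nonsquares :: 'a set) * of_bool (coeff h 2 = 0)
    = card (nonsquares :: 'a set) + (\<Sum>n\<in>nonsquares. card {x. poly h x = n * coeff h 2})"
proof -
  define a d where "a = coeff h 2" and "d = coeff h 1 + a * r"
  have h: "poly h x = (x - r) * (a * x + d)" for x
  proof -
    have "poly h x = poly h x - poly h r"
      using root by simp
    also have "\<dots> = (x - r) * (a * x + d)"
      by (simp add: poly_degree_le_2[OF deg] a_def d_def algebra_simps power2_eq_square)
    finally show ?thesis .
  qed
  show ?thesis
  proof (cases "a = 0")
    case True
    have "card {x. poly h x = 0} = (if d = 0 then CARD('a) else 1)"
      by (auto simp: h True)
    then show ?thesis
      using True by (auto simp: a_def[symmetric] h)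
  next
    case False
    define s where "s = - d / a"
    have hs: "poly h x = a * ((x - r) * (x - s))" for x
      using False by (simp add: h s_def field_simps)
    have "(\<Sum>n\<in>nonsquares. card {x. poly h x = n * coeff h 2})
        = (\<Sum>n\<in>nonsquares. card {x. (x - r) * (x - s) = n})"
      using False by (simp add: hs flip: a_def)
    also have "\<dots> = card (\<Union>n\<in>nonsquares. {x. (x - r) * (x - s) = n})"
      by (subst card_UN_disjoint) auto
    also have "(\<Union>n\<in>nonsquares. {x. (x - r) * (x - s) = n}) = {x. (x - r) * (x - s) \<in> nonsquares}"
      by auto
    also have "card \<dots> = (if r = s then 0 else card (nonsquares :: 'a set))"
      using card_product_in_nonsquares[of r s]
      by (auto simp: nonsquares_def simp flip: power2_eq_square)
    finally have "(\<Sum>n\<in>nonsquares. card {x. poly h x = n * coeff h 2})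
        = (if r = s then 0 else card (nonsquares :: 'a set))" .
    moreover have "{x. poly h x = 0} = {r, s}"
      using False by (auto simp: hs)
    ultimately show ?thesis
      using False by (auto simp: a_def)
  qed
qed

section \<open>Moments of sums of values\<close>

lemma exists_third_element:
  assumes "CARD('a::finite) > 2"
  shows "\<exists>z. z \<noteq> x \<and> z \<noteq> (y::'a)"
proof (rule ccontr)
  assume "\<not> ?thesis"
  then have "UNIV \<subseteq> {x, y}"
    by auto
  then have "CARD('a) \<le> card {x, y}"
    by (intro card_mono) auto
  also have "\<dots> \<le> 2"
    by (simp add: card_insert_if)
  finally show False
    using assms by simp
qed

text \<open>An auxiliary third abscissa whose value is left free accounts for the factor q.\<close>

lemma sum_evaluate_two:
  fixes x y :: "'a::{field,finite}" and H :: "'a \<Rightarrow> 'a \<Rightarrow> real"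
  assumes "CARD('a) > 2" "x \<noteq> y"
  shows "(\<Sum>f | degree f \<le> 2. H (poly f x) (poly f y)) = real CARD('a) * (\<Sum>a\<in>UNIV. \<Sum>b\<in>UNIV. H a b)"
proof -
  obtain z where "z \<noteq> x" "z \<noteq> y"
    using exists_third_element[OF assms(1)] by blast
  then show ?thesis
    using sum_evaluate[of x y z "\<lambda>a b c. H a b"] assms(2) by (simp add: sum_distrib_left)
qed

lemma sum_evaluate_one:
  fixes x :: "'a::{field,finite}" and H :: "'a \<Rightarrow> real"
  assumes "CARD('a) > 2"
  shows "(\<Sum>f | degree f \<le> 2. H (poly f x)) = real CARD('a) ^ 2 * (\<Sum>a\<in>UNIV. H a)"
proof -
  obtain z where "z \<noteq> x"
    using exists_third_element[OF assms] by blast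
  then show ?thesis
    using sum_evaluate_two[OF assms, of x z "\<lambda>a b. H a"]
    by (simp add: sum_distrib_left power2_eq_square mult.assoc)
qed

text \<open>Values at distinct abscissae are independent and each column has mean zero, so the mixed
  terms vanish.\<close>

lemma second_moment:
  fixes \<phi> :: "'a::{field,finite} \<Rightarrow> 'a \<Rightarrow> real"
  assumes q: "CARD('a) > 2" and mean: "\<And>x. (\<Sum>y\<in>UNIV. \<phi> x y) = 0"
  shows "(\<Sum>f | degree f \<le> 2. (\<Sum>x\<in>UNIV. \<phi> x (poly f x)) ^ 2)
    = real CARD('a) ^ 2 * (\<Sum>x\<in>UNIV. \<Sum>y\<in>UNIV. \<phi> x y ^ 2)"
proof -
  let ?V = "{f::'a poly. degree f \<le> 2}"
  have pair: "(\<Sum>f\<in>?V. \<phi> x (poly f x) * \<phi> y (poly f y))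
      = (if x = y then real CARD('a) ^ 2 * (\<Sum>a\<in>UNIV. \<phi> x a ^ 2) else 0)" for x y
  proof (cases "x = y")
    case True
    then show ?thesis
      using sum_evaluate_one[OF q, of "\<lambda>a. \<phi> x a ^ 2" x] by (simp add: power2_eq_square)
  next
    case False
    then show ?thesis
      using sum_evaluate_two[OF q False, of "\<lambda>a b. \<phi> x a * \<phi> y b"]
      by (simp add: mean flip: sum_distrib_left)
  qed
  have "(\<Sum>f\<in>?V. (\<Sum>x\<in>UNIV. \<phi> x (poly f x)) ^ 2)
      = (\<Sum>f\<in>?V. \<Sum>x\<in>UNIV. \<Sum>y\<in>UNIV. \<phi> x (poly f x) * \<phi> y (poly f y))"
    by (simp add: power2_eq_square sum_product)
  also have "\<dots> = (\<Sum>x\<in>UNIV. \<Sum>y\<in>UNIV. \<Sum>f\<in>?V. \<phi> x (poly f x) * \<phi> y (poly f y))"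
    unfolding sum.swap[of _ UNIV ?V] ..
  also have "\<dots> = real CARD('a) ^ 2 * (\<Sum>x\<in>UNIV. \<Sum>y\<in>UNIV. \<phi> x y ^ 2)"
    by (simp add: pair sum_distrib_left)
  finally show ?thesis .
qed

text \<open>In the expanded cube, a term in which some abscissa occurs exactly once vanishes by
  independence and mean zero. With three factors only the full diagonal x = y = z survives.\<close>

lemma third_moment:
  fixes \<phi> :: "'a::{field,finite} \<Rightarrow> 'a \<Rightarrow> real"
  assumes q: "CARD('a) > 2" and mean: "\<And>x. (\<Sum>y\<in>UNIV. \<phi> x y) = 0"
  shows "(\<Sum>f | degree f \<le> 2. (\<Sum>x\<in>UNIV. \<phi> x (poly f x)) ^ 3)
    = real CARD('a) ^ 2 * (\<Sum>x\<in>UNIV. \<Sum>y\<in>UNIV. \<phi> x y ^ 3)"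
proof -
  let ?V = "{f::'a poly. degree f \<le> 2}"
  have two: "(\<Sum>f\<in>?V. \<phi> x (poly f x) ^ 2 * \<phi> y (poly f y)) = 0" if "x \<noteq> y" for x y
    using sum_evaluate_two[OF q that, of "\<lambda>a b. \<phi> x a ^ 2 * \<phi> y b"]
    by (simp add: mean flip: sum_distrib_left)
  have triple: "(\<Sum>f\<in>?V. \<phi> x (poly f x) * \<phi> y (poly f y) * \<phi> z (poly f z))
      = (if x = y then if x = z then real CARD('a) ^ 2 * (\<Sum>a\<in>UNIV. \<phi> x a ^ 3) else 0 else 0)" for x y z
  proof -
    consider "x = y" "x = z" | "x = y" "x \<noteq> z" | "x \<noteq> y" "x = z" | "x \<noteq> y" "y = z"
      | "x \<noteq> y" "x \<noteq> z" "y \<noteq> z"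
      by blast
    then show ?thesis
    proof cases
      case 1
      then show ?thesis
        using sum_evaluate_one[OF q, of "\<lambda>a. \<phi> x a ^ 3" x] by (simp add: power3_eq_cube)
    next
      case 2
      then show ?thesis
        using two[of x z] by (simp add: power2_eq_square)
    next
      case 3
      then show ?thesis
        using two[of x y] by (simp add: power2_eq_square mult_ac)
    next
      case 4
      then show ?thesis
        using two[of y x] by (simp add: power2_eq_square mult_ac)
    next
      case 5
      then show ?thesis
        using sum_evaluate[OF 5, of "\<lambda>a b c. \<phi> x a * \<phi> y b * \<phi> z c"]
        by (simp add: mean flip: sum_distrib_left)
    qed
  qed
  have cube: "(\<Sum>x\<in>UNIV. w x) ^ 3 = (\<Sum>x\<in>UNIV. \<Sum>y\<in>UNIV. \<Sum>z\<in>UNIV. w x * w y * w z)"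
    for w :: "'a \<Rightarrow> real"
  proof -
    have "(\<Sum>x\<in>UNIV. w x) ^ 3 = (\<Sum>x\<in>UNIV. \<Sum>y\<in>UNIV. w x * w y) * (\<Sum>z\<in>UNIV. w z)"
      by (simp add: power3_eq_cube flip: sum_product)
    then show ?thesis
      by (simp only: sum_distrib_right) (simp only: sum_distrib_left)
  qed
  have "(\<Sum>f\<in>?V. (\<Sum>x\<in>UNIV. \<phi> x (poly f x)) ^ 3)
      = (\<Sum>f\<in>?V. \<Sum>x\<in>UNIV. \<Sum>y\<in>UNIV. \<Sum>z\<in>UNIV. \<phi> x (poly f x) * \<phi> y (poly f y) * \<phi> z (poly f z))"
    unfolding cube ..
  also have "\<dots> = (\<Sum>x\<in>UNIV. \<Sum>y\<in>UNIV. \<Sum>z\<in>UNIV. \<Sum>f\<in>?V. \<phi> x (poly f x) * \<phi> y (poly f y) * \<phi> z (poly f z))"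
    unfolding sum.swap[of _ UNIV ?V] ..
  also have "\<dots> = (\<Sum>x\<in>UNIV. real CARD('a) ^ 2 * (\<Sum>a\<in>UNIV. \<phi> x a ^ 3))"
  proof (rule sum.cong[OF refl])
    fix x
    have "(\<Sum>y\<in>UNIV. \<Sum>z\<in>UNIV. \<Sum>f\<in>?V. \<phi> x (poly f x) * \<phi> y (poly f y) * \<phi> z (poly f z))
      = (\<Sum>y\<in>UNIV. if x = y then real CARD('a) ^ 2 * (\<Sum>a\<in>UNIV. \<phi> x a ^ 3) else 0)"
      by (intro sum.cong refl) (simp add: triple)
    then show "(\<Sum>y\<in>UNIV. \<Sum>z\<in>UNIV. \<Sum>f\<in>?V. \<phi> x (poly f x) * \<phi> y (poly f y) * \<phi> z (poly f z))
      = real CARD('a) ^ 2 * (\<Sum>a\<in>UNIV. \<phi> x a ^ 3)"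
      by simp
  qed
  also have "\<dots> = real CARD('a) ^ 2 * (\<Sum>x\<in>UNIV. \<Sum>y\<in>UNIV. \<phi> x y ^ 3)"
    by (simp add: sum_distrib_left)
  finally show ?thesis .
qed

section \<open>Intersecting families of quadratic polynomials\<close>

lemma sum_fibre_card:
  fixes L :: "'b \<Rightarrow> 'a::finite"
  assumes "finite U"
  shows "(\<Sum>c\<in>UNIV. real (card {f\<in>U. L f = c}) * F c) = (\<Sum>f\<in>U. F (L f))"
proof -
  have "(\<Sum>c\<in>UNIV. real (card {f\<in>U. L f = c}) * F c) = (\<Sum>c\<in>UNIV. \<Sum>f\<in>U. if L f = c then F c else 0)"
    using assms by (simp add: sum.If_cases Int_def)
  also have "\<dots> = (\<Sum>f\<in>U. F (L f))"
    by (subst sum.swap) simp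
  finally show ?thesis .
qed

lemma sum_fibre_card_squared:
  fixes L :: "'b \<Rightarrow> 'a::finite"
  assumes "finite U"
  shows "(\<Sum>c\<in>UNIV. real (card {f\<in>U. L f = c}) ^ 2) = (\<Sum>f\<in>U. \<Sum>g\<in>U. of_bool (L f = L g))"
  using sum_fibre_card[OF assms, of L "\<lambda>c. real (card {f\<in>U. L f = c})"] assms
  by (simp add: Int_def power2_eq_square eq_commute)

lemma card_squared_le_collisions:
  fixes L :: "'b \<Rightarrow> 'a::finite"
  assumes "finite U"
  shows "real (card U) ^ 2 \<le> real CARD('a) * (\<Sum>f\<in>U. \<Sum>g\<in>U. of_bool (L f = L g))"
proof -
  have "(\<Sum>c\<in>UNIV. real (card {f\<in>U. L f = c})) = real (card U)"
    using sum_fibre_card[OF assms, of L "\<lambda>c. 1"] by simp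
  then have "real (card U) ^ 2 \<le> (\<Sum>c\<in>UNIV. real (card {f\<in>U. L f = c}) ^ 2) * real CARD('a)"
    using sum_squared_le_sum_of_squares[of "\<lambda>c. real (card {f\<in>U. L f = c})" UNIV] by simp
  then show ?thesis
    by (simp add: sum_fibre_card_squared[OF assms] mult.commute)
qed

section \<open>Popularity of points in an intersecting family\<close>

context
  fixes U :: "'a::{field,finite} poly set"
  assumes odd_card: "odd CARD('a)"
    and card_gt_2: "CARD('a) > 2"
    and deg: "\<And>f. f \<in> U \<Longrightarrow> degree f \<le> 2"
    and intersecting: "intersecting_family U"
begin

definition popularity :: "'a \<Rightarrow> 'a \<Rightarrow> nat" where
  "popularity x y = card {f\<in>U. poly f x = y}"

lemma finite_family: "finite U"
  using deg by (intro finite_subset[OF _ card_degree_le_2(1)]) auto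

text \<open>At a shared point the equal quadratic and linear terms cancel, leaving equal constant
  terms. Members are thus determined by two coefficients.\<close>

lemma intersecting_eqI:
  assumes "f \<in> U" "g \<in> U" "coeff f 2 = coeff g 2" "coeff f 1 = coeff g 1"
  shows "f = g"
proof -
  obtain x where "poly f x = poly g x"
    using intersecting assms(1,2) by (auto simp: intersecting_family_def)
  then have "coeff f 0 = coeff g 0"
    using assms deg by (simp add: poly_degree_le_2)
  then show ?thesis
    using assms deg by (metis degree_le_2_eq)
qed

lemma card_family_le: "card U \<le> CARD('a) ^ 2"
proof -
  have "inj_on (\<lambda>f. (coeff f 2, coeff f 1)) U"
    by (intro inj_onI intersecting_eqI) auto
  then have "card U \<le> card (UNIV :: ('a \<times> 'a) set)"
    by (rule card_inj_on_le) auto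
  then show ?thesis
    by (simp add: power2_eq_square)
qed

text \<open>For f through (x, y), f - g expanded at x has the fixed constant term c, which is
  nonzero, and has a root because the family is intersecting. Its discriminant is therefore a
  square. The linear coefficient and the discriminant determine f, leaving q times at most (q+1)/2
  possibilities.\<close>

lemma popularity_le_of_missing:
  assumes "g \<in> U" "poly g x \<noteq> y"
  shows "2 * popularity x y \<le> CARD('a) * (CARD('a) + 1)"
proof -
  let ?S = "range (\<lambda>y::'a. y ^ 2)"
  define c where "c = y - poly g x"
  have "c \<noteq> 0"
    using assms by (simp add: c_def)
  \<comment> \<open>Coefficients of \<open>f - g\<close> as a polynomial in \<open>X - x\<close>; its constant coefficient is \<open>c\<close>.\<close>
  define a b where "a f = coeff f 2 - coeff g 2"
    and "b f = coeff f 1 - coeff g 1 + 2 * x * a f" for f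
  have diff: "poly f t - poly g t = c + b f * (t - x) + a f * (t - x) ^ 2"
    if "f \<in> U" "poly f x = y" for f t
  proof -
    have "c = poly f x - poly g x"
      using that by (simp add: c_def)
    then show ?thesis
      using that assms deg
      by (simp add: poly_degree_le_2 a_def b_def algebra_simps power2_eq_square)
  qed
  have inj: "inj_on (\<lambda>f. (b f, b f ^ 2 - 4 * a f * c)) {f\<in>U. poly f x = y}"
  proof (rule inj_onI, goal_cases)
    case (1 f f')
    have "(4::'a) = 2 * 2"
      by simp
    then have "(4::'a) \<noteq> 0"
      using two_neq_zero_if_odd_CARD[OF odd_card] by (metis mult_eq_0_iff)
    moreover have "4 * (a f * c) = 4 * (a f' * c)"
      using 1(3) by (auto simp: mult.assoc)
    ultimately have "a f = a f'"
      using \<open>c \<noteq> 0\<close> by (metis mult_left_cancel mult_right_cancel)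
    with 1 show ?case
      by (intro intersecting_eqI) (auto simp: a_def b_def)
  qed
  have "(\<lambda>f. (b f, b f ^ 2 - 4 * a f * c)) ` {f\<in>U. poly f x = y} \<subseteq> UNIV \<times> ?S"
  proof (rule image_subsetI)
    fix f assume "f \<in> {f\<in>U. poly f x = y}"
    then have f: "f \<in> U" "poly f x = y"
      by auto
    obtain t where t: "poly f t = poly g t"
      using f assms intersecting by (auto simp: intersecting_family_def)
    define u where "u = t - x"
    have "c + b f * u + a f * u ^ 2 = 0"
      using diff[of f t] f t by (simp add: u_def)
    then have c: "c = - b f * u - a f * u ^ 2"
      by (simp add: algebra_simps eq_neg_iff_add_eq_0)
    \<comment> \<open>The discriminant is the square of the derivative at the root; this also covers
      \<open>a f = 0\<close>.\<close>
    have "b f ^ 2 - 4 * a f * c = (b f + 2 * a f * u) ^ 2"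
      unfolding c by (simp add: algebra_simps power2_eq_square)
    then show "(b f, b f ^ 2 - 4 * a f * c) \<in> UNIV \<times> ?S"
      by blast
  qed
  then have "popularity x y \<le> card ((UNIV :: 'a set) \<times> ?S)"
    unfolding popularity_def using inj by (intro card_inj_on_le) auto
  then have "2 * popularity x y \<le> CARD('a) * (2 * card ?S)"
    by (simp add: card_cartesian_product)
  also have "\<dots> \<le> CARD('a) * (CARD('a) + 1)"
    by (rule mult_le_mono2[OF card_range_square_le[OF odd_card]])
  finally show ?thesis .
qed

lemma sum_popularity: "(\<Sum>y\<in>UNIV. real (popularity x y)) = real (card U)"
  using sum_fibre_card[OF finite_family, of "\<lambda>f. poly f x" "\<lambda>_. 1"] by (simp add: popularity_def)

lemma sum_popularity_squared:
  "(\<Sum>x\<in>UNIV. \<Sum>y\<in>UNIV. real (popularity x y) ^ 2) \<ge> 2 * real (card U) ^ 2 - real CARD('a) * real (card U)"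
proof -
  let ?NS = "nonsquares :: 'a set" and ?N = "real (card U)" and ?q = "real CARD('a)"
  define p where "p = real (card ?NS)"
  have p: "p > 0"
    using card_nonsquares_pos[OF odd_card] card_gt_2 by (simp add: p_def)
  \<comment> \<open>\<open>Z\<close> counts common points, \<open>E\<close> marks equal quadratic
    coefficients, and \<open>P\<close> counts the coincidences bounded below by Cauchy-Schwarz.
    Summed over all pairs in \<open>U\<close>, \<open>Z\<close> is the required sum of
    squares.\<close>
  define Z E P where "Z f g = (\<Sum>x\<in>UNIV. of_bool (poly f x = poly g x) :: real)"
    and "E f g = (of_bool (coeff f 2 = coeff g 2) :: real)"
    and "P f g = (\<Sum>n\<in>?NS. \<Sum>x\<in>UNIV. of_bool (poly f x - n * coeff f 2 = poly g x - n * coeff g 2) :: real)"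
    for f g :: "'a poly"
  have pair: "p * Z f g + p * E f g = p + P f g" if fg: "f \<in> U" "g \<in> U" for f g
  proof -
    obtain r where r: "poly (f - g) r = 0"
      using intersecting fg by (auto simp: intersecting_family_def)
    have "degree (f - g) \<le> 2"
      using deg fg by (intro degree_diff_le) auto
    from arg_cong[OF poly_with_root_count[OF this r], of real] show ?thesis
      by (simp add: Z_def E_def P_def p_def Int_def algebra_simps)
  qed
  \<comment> \<open>Each of the p q choices of n and x contributes at least N^2/q coinciding
    pairs.\<close>
  have "p * ?N ^ 2 = (\<Sum>n\<in>?NS. \<Sum>x\<in>(UNIV::'a set). ?N ^ 2 / ?q)"
    by (simp add: p_def)
  also have "\<dots> \<le> (\<Sum>n\<in>?NS. \<Sum>x\<in>UNIV. \<Sum>f\<in>U. \<Sum>g\<in>U.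
      of_bool (poly f x - n * coeff f 2 = poly g x - n * coeff g 2))"
    using card_squared_le_collisions[OF finite_family]
    by (intro sum_mono) (simp add: divide_le_eq mult.commute)
  also have "\<dots> = (\<Sum>f\<in>U. \<Sum>g\<in>U. P f g)"
    unfolding P_def sum.swap[of _ U UNIV] sum.swap[of _ U ?NS] ..
  finally have P: "p * ?N ^ 2 \<le> (\<Sum>f\<in>U. \<Sum>g\<in>U. P f g)" .
  have E: "(\<Sum>f\<in>U. \<Sum>g\<in>U. E f g) \<le> ?q * ?N"
  proof -
    \<comment> \<open>Members with the same quadratic coefficient have distinct linear
      coefficients.\<close>
    have "card {g\<in>U. coeff f 2 = coeff g 2} \<le> CARD('a)" for f
    proof (rule card_inj_on_le)
      show "inj_on (\<lambda>g. coeff g 1) {g\<in>U. coeff f 2 = coeff g 2}"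
        by (rule inj_onI) (auto intro: intersecting_eqI simp del: One_nat_def)
    qed auto
    then have "(\<Sum>g\<in>U. E f g) \<le> ?q" for f
      by (simp add: E_def Int_def finite_family)
    then have "(\<Sum>f\<in>U. \<Sum>g\<in>U. E f g) \<le> (\<Sum>f\<in>U. ?q)"
      by (intro sum_mono)
    then show ?thesis
      by (simp add: mult.commute)
  qed
  have "(\<Sum>f\<in>U. \<Sum>g\<in>U. p * Z f g + p * E f g) = (\<Sum>f\<in>U. \<Sum>g\<in>U. p + P f g)"
    by (intro sum.cong refl pair)
  then have "p * (\<Sum>f\<in>U. \<Sum>g\<in>U. Z f g) + p * (\<Sum>f\<in>U. \<Sum>g\<in>U. E f g) = p * ?N ^ 2 + (\<Sum>f\<in>U. \<Sum>g\<in>U. P f g)"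
    by (simp add: sum.distrib sum_distrib_left power2_eq_square mult_ac)
  then have "p * ((\<Sum>f\<in>U. \<Sum>g\<in>U. Z f g) + (\<Sum>f\<in>U. \<Sum>g\<in>U. E f g)) \<ge> p * (2 * ?N ^ 2)"
    using P by (simp add: distrib_left)
  then have "(\<Sum>f\<in>U. \<Sum>g\<in>U. Z f g) + (\<Sum>f\<in>U. \<Sum>g\<in>U. E f g) \<ge> 2 * ?N ^ 2"
    using p by (simp only: mult_le_cancel_left_pos)
  moreover have "(\<Sum>x\<in>UNIV. \<Sum>y\<in>UNIV. real (popularity x y) ^ 2) = (\<Sum>f\<in>U. \<Sum>g\<in>U. Z f g)"
    unfolding popularity_def sum_fibre_card_squared[OF finite_family] Z_def sum.swap[of _ U UNIV] ..
  ultimately show ?thesis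
    using E by linarith
qed

section \<open>Moments of the centred popularity\<close>

definition excess :: "'a \<Rightarrow> 'a \<Rightarrow> real" where
  "excess x y = real (popularity x y) - real (card U) / real CARD('a)"

lemma sum_excess: "(\<Sum>y\<in>UNIV. excess x y) = 0"
  by (simp add: excess_def sum_subtractf sum_popularity)

text \<open>Regrouping by points weights each excess by its popularity, which is excess plus N/q;
  the constant part disappears because columns sum to zero.\<close>

lemma sum_over_family_excess:
  "(\<Sum>f\<in>U. \<Sum>x\<in>UNIV. excess x (poly f x)) = (\<Sum>x\<in>UNIV. \<Sum>y\<in>UNIV. excess x y ^ 2)"
proof -
  have "(\<Sum>f\<in>U. \<Sum>x\<in>UNIV. excess x (poly f x)) = (\<Sum>x\<in>UNIV. \<Sum>y\<in>UNIV. real (popularity x y) * excess x y)"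
    unfolding popularity_def sum_fibre_card[OF finite_family] by (rule sum.swap)
  also have "\<dots> = (\<Sum>x\<in>UNIV. \<Sum>y\<in>UNIV. excess x y ^ 2 + real (card U) / real CARD('a) * excess x y)"
    by (intro sum.cong refl) (simp add: excess_def algebra_simps power2_eq_square)
  also have "\<dots> = (\<Sum>x\<in>UNIV. \<Sum>y\<in>UNIV. excess x y ^ 2)"
    by (simp add: sum.distrib sum_excess flip: sum_distrib_left sum_divide_distrib)
  finally show ?thesis .
qed

lemma sum_excess_squared:
  "(\<Sum>x\<in>UNIV. \<Sum>y\<in>UNIV. excess x y ^ 2) \<ge> real (card U) * (real (card U) - real CARD('a))"
proof -
  let ?N = "real (card U)" and ?q = "real CARD('a)"
  have "(\<Sum>y\<in>UNIV. excess x y ^ 2) = (\<Sum>y\<in>UNIV. real (popularity x y) ^ 2) - ?N ^ 2 / ?q" for x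
  proof -
    have "(\<Sum>y\<in>UNIV. excess x y ^ 2)
        = (\<Sum>y\<in>UNIV. real (popularity x y) ^ 2 - 2 * ?N / ?q * real (popularity x y) + (?N / ?q) ^ 2)"
      by (intro sum.cong refl) (simp add: excess_def power2_diff)
    also have "\<dots> = (\<Sum>y\<in>UNIV. real (popularity x y) ^ 2) - 2 * ?N / ?q * ?N + ?q * (?N / ?q) ^ 2"
      unfolding sum.distrib sum_subtractf sum_distrib_left[symmetric] sum_popularity by simp
    also have "\<dots> = (\<Sum>y\<in>UNIV. real (popularity x y) ^ 2) - ?N ^ 2 / ?q"
      by (simp add: power2_eq_square)
    finally show ?thesis .
  qed
  then have "(\<Sum>x\<in>UNIV. \<Sum>y\<in>UNIV. excess x y ^ 2)
      = (\<Sum>x\<in>UNIV. \<Sum>y\<in>UNIV. real (popularity x y) ^ 2) - ?N ^ 2"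
    by (simp add: sum_subtractf)
  then show ?thesis
    using sum_popularity_squared by (simp add: algebra_simps power2_eq_square)
qed

text \<open>With k = q^2, the cubic t^2(t + k) is nonnegative for t at least -k and has a double
  zero at 0, near which G should lie off \<open>U\<close>. On \<open>U\<close>, where G should be
  near k, it is bounded below by its tangent at k. Summing both bounds over all quadratics and
  inserting the moments gives the claim.\<close>

lemma sum_excess_cubed:
  "(\<Sum>x\<in>UNIV. \<Sum>y\<in>UNIV. excess x y ^ 3)
    \<ge> 4 * real CARD('a) ^ 2 * (\<Sum>x\<in>UNIV. \<Sum>y\<in>UNIV. excess x y ^ 2) - 3 * real CARD('a) ^ 4 * real (card U)"
proof -
  let ?V = "{f::'a poly. degree f \<le> 2}"
  define k where "k = real CARD('a) ^ 2"
  have k: "k > 0"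
    by (simp add: k_def)
  define G where "G f = (\<Sum>x\<in>UNIV. excess x (poly f x))" for f
  define S2 S3 where "S2 = (\<Sum>x\<in>UNIV. \<Sum>y\<in>UNIV. excess x y ^ 2)"
    and "S3 = (\<Sum>x\<in>UNIV. \<Sum>y\<in>UNIV. excess x y ^ 3)"
  have G_ge: "G f \<ge> - k" for f
  proof -
    \<comment> \<open>Each of the q columns contributes at least -N/q, for a total of -N, and N is
      at most k.\<close>
    have "G f \<ge> (\<Sum>x\<in>(UNIV::'a set). - (real (card U) / real CARD('a)))"
      unfolding G_def by (intro sum_mono) (simp add: excess_def)
    moreover have "real (card U) \<le> k"
      using card_family_le by (simp add: k_def flip: of_nat_power)
    ultimately show ?thesis
      by simp
  qed
  \<comment> \<open>The right side is the tangent at k, where the cubic has value 2k^3 and slope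
    5k^2. The double contact leaves the factor G + 3k, which is positive since G is at least
    -k.\<close>
  have in_U: "G f ^ 3 + k * G f ^ 2 \<ge> 5 * k ^ 2 * G f - 3 * k ^ 3" for f
  proof -
    have "G f ^ 3 + k * G f ^ 2 - (5 * k ^ 2 * G f - 3 * k ^ 3) = (G f - k) ^ 2 * (G f + 3 * k)"
      by (simp add: algebra_simps power2_eq_square power3_eq_cube)
    moreover have "\<dots> \<ge> 0"
      using G_ge[of f] k by (intro mult_nonneg_nonneg) auto
    ultimately show ?thesis
      by linarith
  qed
  have off_U: "G f ^ 3 + k * G f ^ 2 \<ge> 0" for f
  proof -
    have "G f ^ 3 + k * G f ^ 2 = G f ^ 2 * (G f + k)"
      by (simp add: algebra_simps power2_eq_square power3_eq_cube)
    then show ?thesis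
      using G_ge[of f] by simp
  qed
  have "5 * k ^ 2 * S2 - 3 * k ^ 3 * real (card U) = (\<Sum>f\<in>U. 5 * k ^ 2 * G f - 3 * k ^ 3)"
    by (simp add: S2_def G_def sum_subtractf sum_over_family_excess flip: sum_distrib_left)
  also have "\<dots> \<le> (\<Sum>f\<in>U. G f ^ 3 + k * G f ^ 2)"
    by (intro sum_mono in_U)
  also have "\<dots> \<le> (\<Sum>f\<in>?V. G f ^ 3 + k * G f ^ 2)"
    using deg off_U by (intro sum_mono2 card_degree_le_2) auto
  also have "\<dots> = k * S3 + k * (k * S2)"
    unfolding G_def sum.distrib sum_distrib_left[symmetric]
    by (simp add: second_moment third_moment card_gt_2 sum_excess S2_def S3_def k_def)
  finally have "k * (4 * k * S2 - 3 * k ^ 2 * real (card U)) \<le> k * S3"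
    by (simp add: algebra_simps power2_eq_square power3_eq_cube)
  then have "4 * k * S2 - 3 * k ^ 2 * real (card U) \<le> S3"
    using k by (simp only: mult_le_cancel_left_pos)
  then show ?thesis
    by (simp add: S2_def S3_def k_def flip: power_mult)
qed

text \<open>Without a common point every excess is at most q^2/2, so S3 is at most q^2/2 times S2.
  Against the lower bound 4 q^2 S2 - 3 q^4 N this gives 7 S2 at most 6 q^2 N. Since S2 is at least
  N(N - q), it follows that 7(N - q) is at most 6 q^2, which is the threshold in the
  hypothesis.\<close>

lemma common_point:
  assumes large: "7 * real (card U) > 6 * real CARD('a) ^ 2 + 7 * real CARD('a)"
  shows "\<exists>x y. \<forall>f\<in>U. poly f x = y"
proof (rule ccontr)
  assume no_point: "\<not> ?thesis"
  define N q where "N = real (card U)" and "q = real CARD('a)"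
  define S2 S3 where "S2 = (\<Sum>x\<in>UNIV. \<Sum>y\<in>UNIV. excess x y ^ 2)"
    and "S3 = (\<Sum>x\<in>UNIV. \<Sum>y\<in>UNIV. excess x y ^ 3)"
  have q: "q > 0"
    by (simp add: q_def)
  have N: "7 * N > 6 * q ^ 2 + 7 * q"
    using large by (simp add: N_def q_def)
  then have "N > 0" "q ^ 2 / 2 \<le> N"
    using q by (smt (verit) zero_le_power2 field_sum_of_halves)+
  then have "q / 2 \<le> N / q"
    using q by (simp add: field_simps power2_eq_square)
  \<comment> \<open>Subtracting the mean N/q, which is at least q/2, absorbs the linear term of
    q(q+1)/2.\<close>
  have excess_le: "excess x y \<le> q ^ 2 / 2" for x y
  proof -
    have "2 * popularity x y \<le> CARD('a) * (CARD('a) + 1)"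
      using no_point popularity_le_of_missing by blast
    then have "real (2 * popularity x y) \<le> real (CARD('a) * (CARD('a) + 1))"
      by (simp only: of_nat_le_iff)
    then have "2 * real (popularity x y) \<le> q * (q + 1)"
      by (simp add: q_def algebra_simps)
    then show ?thesis
      using \<open>q / 2 \<le> N / q\<close> by (simp add: excess_def N_def q_def power2_eq_square algebra_simps)
  qed
  have "S3 \<le> (\<Sum>x\<in>UNIV. \<Sum>y\<in>UNIV. q ^ 2 / 2 * excess x y ^ 2)"
    unfolding S3_def
  proof (intro sum_mono)
    fix x y
    show "excess x y ^ 3 \<le> q ^ 2 / 2 * excess x y ^ 2"
      using mult_right_mono[OF excess_le[of x y], of "excess x y ^ 2"]
      by (simp add: power3_eq_cube power2_eq_square mult.assoc)
  qed
  then have "S3 \<le> q ^ 2 / 2 * S2"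
    by (simp add: S2_def sum_distrib_left)
  moreover have "4 * q ^ 2 * S2 - 3 * q ^ 4 * N \<le> S3"
    using sum_excess_cubed by (simp add: S2_def S3_def N_def q_def)
  ultimately have "q ^ 2 * (7 * S2) \<le> q ^ 2 * (6 * q ^ 2 * N)"
    by (simp add: algebra_simps flip: power_add)
  then have "7 * S2 \<le> 6 * q ^ 2 * N"
    using q by (simp only: mult_le_cancel_left_pos zero_less_power)
  moreover have "N * (N - q) \<le> S2"
    using sum_excess_squared by (simp add: S2_def N_def q_def)
  ultimately have "N * (7 * (N - q)) \<le> N * (6 * q ^ 2)"
    by (simp add: algebra_simps)
  then show False
    using N \<open>N > 0\<close> by simp
qed

end

section \<open>From the bound on the deficiency to the size threshold\<close>

theorem theorem4:
  fixes U :: "'a::{field,finite} poly set" and eps :: real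
  assumes "CARD('a) > 9" and "odd CARD('a)"
    and "\<forall>f\<in>U. degree f \<le> 2"
    and "intersecting_family U"
    and "real (card U) = real (CARD('a))^2 - eps"
    and "eps < real (CARD('a)) * sqrt (real (CARD('a))) / 4 - 3 * real (CARD('a)) / 8
              - sqrt (real (CARD('a))) / 8"
  shows "\<exists>x y. \<forall>f\<in>U. poly f x = y"
proof (rule common_point)
  define s where "s = sqrt (real CARD('a))"
  have q: "real CARD('a) = s ^ 2"
    by (simp add: s_def)
  have "CARD('a) \<noteq> 10"
    using assms(2) by auto
  then have "real CARD('a) \<ge> 11"
    using assms(1) by linarith
  then have "s \<ge> sqrt 11"
    by (simp add: s_def)
  moreover have "sqrt 11 \<ge> (33 / 10 :: real)"
    by (rule real_le_rsqrt) (simp add: power2_eq_square)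
  ultimately have s: "s \<ge> 33 / 10"
    by linarith
  \<comment> \<open>The target is 7 eps < s^4 - 7 s^2. After inserting the bound on eps and dropping
    its term -7s/8, it reduces to s^2 - 7s/4 - 35/8 being nonnegative. This fails at s = 3, but
    holds from s = 3.3 on, which q at least 11 guarantees.\<close>
  have "s * (s - 7 / 4) \<ge> 33 / 10 * (33 / 10 - 7 / 4)"
    using s by (intro mult_mono) auto
  then have "s ^ 2 - 7 / 4 * s - 35 / 8 \<ge> 0"
    by (simp add: algebra_simps power2_eq_square)
  then have "s ^ 2 * (s ^ 2 - 7 / 4 * s - 35 / 8) \<ge> 0"
    by simp
  moreover have "7 * eps < 7 * (s ^ 2 * s / 4 - 3 * s ^ 2 / 8 - s / 8)"
    using assms(6) by (simp add: s_def)
  ultimately have "7 * eps < (s ^ 2) ^ 2 - 7 * s ^ 2"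
    using s by (simp add: algebra_simps power2_eq_square)
  then show "7 * real (card U) > 6 * real CARD('a) ^ 2 + 7 * real CARD('a)"
    unfolding assms(5) q by simp
qed (use assms in auto)

end
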